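(* Let the setting be as in the context: data process $(Z_n)_{n\in\mathbb{N}}$ with values in a metric space $\mathcal{Z}$, parameter space $\Theta$, decision space $\mathcal{X}$, cost function $c$ with associated $\mathsf{Regret}$, penalty function $\ell$, and constant $r>0$. Suppose that for each $\theta\in\Theta$ the asymptotic risk measure $\phi_\theta$ and the rate function $\mathcal{I}$ satisfy the Laplace principle $$\phi_\theta[(f(Z_n))_{n\in\mathbb{N}}]=\sup_{z\in\mathcal{Z}}\{f(z)-\mathcal{I}_\theta(z)\}\qquad\text{for all } f\in\mathcal{C}(\mathcal{Z}),\ \theta\in\Theta,$$ and suppose that $\mathcal{I}:\Theta\times\mathcal{Z}\to[0,\infty]$ satisfies the regularity conditions (I), (II), (III) listed in the context. For $z\in\mathcal{Z}$ define $$X^\star(z)=\operatorname*{arg\,min}_{x\in\mathcal{X}}\max_{\theta\in\Theta}\{\mathsf{Regret}(x,\theta)-\ell^{-1}(\mathcal{I}_\theta(z)-r)\},\qquad u^\star(z)=\min_{x\in\mathcal{X}}\max_{\theta\in\Theta}\{\mathsf{Regret}(x,\theta)-\ell^{-1}(\mathcal{I}_\theta(z)-r)\}.$$ Then: (a) $(X^\star,u^\star)$ is feasible, i.e. $X^\star\in\mathcal{C}(\mathcal{Z},\mathcal{X})$, $u^\star\in\mathcal{C}(\mathcal{Z})$, and $$\phi_\theta\big[\big(\ell(\mathsf{Regret}(X^\star(Z_n),\theta)-u^\star(Z_n))\big)_{n\in\mathbb{N}}\big]\le -r\qquad\text{for all }\theta\in\Theta.$$ (b) $(X^\star,u^\star)$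 is optimal, i.e. for every other feasible pair $(X,u)$, meaning $X\in\mathcal{C}(\mathcal{Z},\mathcal{X})$, $u\in\mathcal{C}(\mathcal{Z})$ and $\phi_\theta[(\ell(\mathsf{Regret}(X(Z_n),\theta)-u(Z_n)))_{n\in\mathbb{N}}]\le -r$ for all $\theta\in\Theta$, one has $u^\star(z)\le u(z)$ for all $z\in\mathcal{Z}$.
   Context: Setting. $\mathcal{Z}$ is a non-empty metric space. $\Theta$ and $\mathcal{X}$ are non-empty, metric, compact and convex (i.e. compact convex subsets of real topological vector spaces whose subspace topologies are metrizable). For each $\theta\in\Theta$, $(Z_n)_{n\in\mathbb{N}}$ is a sequence of $\mathcal{Z}$-valued random variables on a probability space $(\Omega,\mathcal{F},\mathbb{P}_\theta)$. $\mathcal{C}(A,B)$ denotes the continuous functions $A\to B$, and $\mathcal{C}(A)=\mathcal{C}(A,\mathbb{R})$. Cost and regret. $c:\mathcal{X}\times\Theta\to\mathbb{R}$ is continuous, and $x\mapsto c(x,\theta)$ is strictly convex for every $\theta\in\Theta$. $\mathsf{Regret}(x,\theta)=c(x,\theta)-\min_{y\in\mathcal{X}}c(y,\theta)$. Penalty. $\ell:\mathbb{R}\to\mathbb{R}$ is an increasing continuous bijection with $\ell(0)=0$, extended by $\ell(\pm\infty)=\pm\infty$; $\ell^{-1}:[-\infty,\infty]\to[-\infty,\infty]$ is its inverse. $r>0$ is a fixed real number. Asymptotic risk measure. For each $\theta\in\Theta$, $\phi_\theta$ is a functional assigning to each sequence $(f(Z_n))_{n\in\mathbb{N}}$ with $f\in\mathcal{C}(\mathcal{Z})$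 a value in $[-\infty,\infty]$. Rate function. $\mathcal{I}:\Theta\times\mathcal{Z}\to[0,\infty]$, $(\theta,z)\mapsto\mathcal{I}_\theta(z)$. Regularity conditions: (I) for every $z\in\mathcal{Z}$ there is $\theta\in\Theta$ with $\mathcal{I}_\theta(z)<\infty$; (II) $\mathcal{I}$ is lower semicontinuous on $\Theta\times\mathcal{Z}$; (III) for every $(\theta,z)\in\Theta\times\mathcal{Z}$ with $\mathcal{I}_\theta(z)<\infty$ and every sequence $(z_n)\subseteq\mathcal{Z}$ with $z_n\to z$ there is a sequence $(\theta_n)\subseteq\Theta$ with $\theta_n\to\theta$ and $\mathcal{I}_{\theta_n}(z_n)\to\mathcal{I}_\theta(z)$. $\operatorname{arg\,min}$ denotes the unique minimizer; under the stated assumptions the maxima are attained and the minimizer exists and is unique. *)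

theory Defs
  imports "HOL-Probability.Probability"
begin

class real_topological_vector_space = real_vector + topological_ab_group_add +
  assumes tendsto_scaleR_nhds:
    "((\<lambda>p. scaleR (fst p) (snd p)) \<longlongrightarrow> scaleR t x) (nhds t \<times>\<^sub>F nhds x)"

instance real_normed_vector \<subseteq> real_topological_vector_space
proof
  fix t :: real and x :: 'a
  have "((\<lambda>p. scaleR (fst p) (snd p)) \<longlongrightarrow> scaleR t x) (nhds (t, x))"
    by (intro tendsto_intros filterlim_ident
        tendsto_fst[where a = "(t, x)", simplified] tendsto_snd[where a = "(t, x)", simplified])
  then show "((\<lambda>p. scaleR (fst p) (snd p)) \<longlongrightarrow> scaleR t x) (nhds t \<times>\<^sub>F nhds x)"
    by (simp add: nhds_prod)
qed

definition strictly_convex_on :: "'a::real_vector set \<Rightarrow> ('a \<Rightarrow> real) \<Rightarrow> bool" where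
  "strictly_convex_on S f \<longleftrightarrow> convex S \<and>
     (\<forall>x\<in>S. \<forall>y\<in>S. \<forall>t. x \<noteq> y \<longrightarrow> 0 < t \<longrightarrow> t < 1 \<longrightarrow>
        f ((1 - t) *\<^sub>R x + t *\<^sub>R y) < (1 - t) * f x + t * f y)"

definition lower_semicontinuous_on :: "'a::topological_space set \<Rightarrow> ('a \<Rightarrow> ereal) \<Rightarrow> bool" where
  "lower_semicontinuous_on S f \<longleftrightarrow> (\<forall>x\<in>S. f x \<le> Liminf (at x within S) f)"

text \<open>Minima and maxima are written as infima and suprema; that they are attained under the
  standing assumptions is part of the conclusion of the theorem.\<close>

definition regret :: "('x \<Rightarrow> 'p \<Rightarrow> real) \<Rightarrow> 'x set \<Rightarrow> 'x \<Rightarrow> 'p \<Rightarrow> real" where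
  "regret c X x \<theta> = c x \<theta> - (INF y\<in>X. c y \<theta>)"

definition extended_penalty :: "(real \<Rightarrow> real) \<Rightarrow> ereal \<Rightarrow> ereal" where
  "extended_penalty l t =
    (case t of ereal s \<Rightarrow> ereal (l s) | PInfty \<Rightarrow> \<infinity> | MInfty \<Rightarrow> -\<infinity>)"

definition penalty_inverse :: "(real \<Rightarrow> real) \<Rightarrow> ereal \<Rightarrow> ereal" where
  "penalty_inverse l = inv (extended_penalty l)"

definition adjusted_regret ::
  "('x \<Rightarrow> 'p \<Rightarrow> real) \<Rightarrow> 'x set \<Rightarrow> (real \<Rightarrow> real) \<Rightarrow> real \<Rightarrow> ('p \<Rightarrow> 'z \<Rightarrow> ereal) \<Rightarrow> 'z \<Rightarrow> 'x \<Rightarrow> 'p \<Rightarrow> ereal"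
  where "adjusted_regret c X l r I z x \<theta> =
    ereal (regret c X x \<theta>) - penalty_inverse l (I \<theta> z - ereal r)"

definition worst_regret ::
  "('x \<Rightarrow> 'p \<Rightarrow> real) \<Rightarrow> 'x set \<Rightarrow> 'p set \<Rightarrow> (real \<Rightarrow> real) \<Rightarrow> real \<Rightarrow> ('p \<Rightarrow> 'z \<Rightarrow> ereal) \<Rightarrow> 'z \<Rightarrow> 'x \<Rightarrow> ereal"
  where "worst_regret c X \<Theta> l r I z x = (SUP \<theta>\<in>\<Theta>. adjusted_regret c X l r I z x \<theta>)"

definition X_star ::
  "('x \<Rightarrow> 'p \<Rightarrow> real) \<Rightarrow> 'x set \<Rightarrow> 'p set \<Rightarrow> (real \<Rightarrow> real) \<Rightarrow> real \<Rightarrow> ('p \<Rightarrow> 'z \<Rightarrow> ereal) \<Rightarrow> 'z \<Rightarrow> 'x"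
  where "X_star c X \<Theta> l r I z = arg_min_on (worst_regret c X \<Theta> l r I z) X"

text \<open>The value is a real number under the standing assumptions, which is again part of the
  conclusion of the theorem, so that the totalisation of \<^const>\<open>real_of_ereal\<close> is not exploited.\<close>

definition u_star ::
  "('x \<Rightarrow> 'p \<Rightarrow> real) \<Rightarrow> 'x set \<Rightarrow> 'p set \<Rightarrow> (real \<Rightarrow> real) \<Rightarrow> real \<Rightarrow> ('p \<Rightarrow> 'z \<Rightarrow> ereal) \<Rightarrow> 'z \<Rightarrow> real"
  where "u_star c X \<Theta> l r I z = real_of_ereal (INF x\<in>X. worst_regret c X \<Theta> l r I z x)"

definition feasible ::
  "('x::topological_space \<Rightarrow> 'p \<Rightarrow> real) \<Rightarrow> 'x set \<Rightarrow> 'p set \<Rightarrow> (real \<Rightarrow> real) \<Rightarrow> real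
    \<Rightarrow> ('p \<Rightarrow> (nat \<Rightarrow> 'w \<Rightarrow> real) \<Rightarrow> ereal) \<Rightarrow> (nat \<Rightarrow> 'w \<Rightarrow> 'z::topological_space)
    \<Rightarrow> ('z \<Rightarrow> 'x) \<Rightarrow> ('z \<Rightarrow> real) \<Rightarrow> bool"
  where "feasible c X \<Theta> l r \<phi> Z d u \<longleftrightarrow>
    continuous_on UNIV d \<and> range d \<subseteq> X \<and> continuous_on UNIV u \<and>
    (\<forall>\<theta>\<in>\<Theta>. \<phi> \<theta> (\<lambda>n \<omega>. l (regret c X (d (Z n \<omega>)) \<theta> - u (Z n \<omega>))) \<le> ereal (- r))"

end

(* Since l is an increasing bijection, Regret(x,theta) - l^(-1)(I_theta(z) - r) <= a is equivalent to
   l (Regret(x,theta) - a) - I_theta(z) <= -r. By the Laplace principle, (X, u) therefore satisfies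
   the risk constraints if and only if the worst adjusted regret of X(z) at z is at most u(z) for
   every z. This gives optimality of the pointwise minimum and the risk bound for it at once, and
   only continuity is left. The worst adjusted regret is jointly continuous in (z, x): upper
   semicontinuity comes from (II) and compactness of Theta, lower semicontinuity from (III). It is
   strictly convex in x because a maximizing theta exists, so over the compact set X both its
   minimum and its unique minimizer depend continuously on z. *)
theory Submission
  imports Defs
begin

section \<open>Compactness arguments with neighbourhood filters\<close>

text \<open>Tube lemma for filters: finitely many neighbourhoods cover \<open>K\<close>, and the
  finitely many attached events of \<open>G\<close> hold simultaneously. \<open>G\<close> is a
  general filter because it will be both a neighbourhood filter and \<open>at_left\<close> of a
  supremum.\<close>

lemma compact_tube_eventually:
  assumes K: "compact K"
    and ev: "\<And>k. k \<in> K \<Longrightarrow> \<forall>\<^sub>F (k', y) in nhds k \<times>\<^sub>F G. k' \<in> K \<longrightarrow> P k' y"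
  shows "\<forall>\<^sub>F y in G. \<forall>k\<in>K. P k y"
proof -
  have "\<exists>U Q. open U \<and> k \<in> U \<and> eventually Q G \<and> (\<forall>k'\<in>U \<inter> K. \<forall>y. Q y \<longrightarrow> P k' y)"
    if k: "k \<in> K" for k
  proof -
    obtain N Q where "eventually N (nhds k)" "eventually Q G"
      and P: "\<And>k' y. N k' \<Longrightarrow> Q y \<Longrightarrow> k' \<in> K \<Longrightarrow> P k' y"
      using ev[OF k] unfolding eventually_prod_filter by auto
    then show ?thesis
      unfolding eventually_nhds by blast
  qed
  then obtain U Q where U: "\<And>k. k \<in> K \<Longrightarrow> open (U k)" "\<And>k. k \<in> K \<Longrightarrow> k \<in> U k"
    and Q: "\<And>k. k \<in> K \<Longrightarrow> eventually (Q k) G"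
    and P: "\<And>k k' y. k \<in> K \<Longrightarrow> k' \<in> U k \<inter> K \<Longrightarrow> Q k y \<Longrightarrow> P k' y"
    by metis
  obtain C where C: "C \<subseteq> K" "finite C" "K \<subseteq> (\<Union>k\<in>C. U k)"
    using compactE_image[OF K, of K U] U by blast
  have "\<forall>\<^sub>F y in G. \<forall>k\<in>C. Q k y"
    using C Q by (intro eventually_ball_finite) auto
  then show ?thesis
    by eventually_elim (use C P in blast)
qed

text \<open>Splits continuity into its lower and upper half, which need different arguments below.
  Membership in \<open>S\<close> is a premise so that the tube lemma can work with plain
  \<open>nhds\<close> filters.\<close>

lemma continuous_on_real_iff_eventually:
  fixes f :: "'a::topological_space \<Rightarrow> real"
  shows "continuous_on S f \<longleftrightarrow>
    (\<forall>x\<in>S. \<forall>a. (a < f x \<longrightarrow> (\<forall>\<^sub>F y in nhds x. y \<in> S \<longrightarrow> a < f y)) \<and>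
      (f x < a \<longrightarrow> (\<forall>\<^sub>F y in nhds x. y \<in> S \<longrightarrow> f y < a)))"
proof -
  have "(f \<longlongrightarrow> f x) (at x within S) \<longleftrightarrow>
      (\<forall>a. (a < f x \<longrightarrow> (\<forall>\<^sub>F y in nhds x. y \<in> S \<longrightarrow> a < f y)) \<and>
        (f x < a \<longrightarrow> (\<forall>\<^sub>F y in nhds x. y \<in> S \<longrightarrow> f y < a)))" for x
    unfolding tendsto_at_iff_tendsto_nhds_within[where f = f and x = x, OF refl]
    unfolding order_tendsto_iff eventually_inf_principal by blast
  then show ?thesis
    unfolding continuous_on_def by simp
qed

text \<open>If the supremum were not attained, \<open>f\<close> would stay below some smaller level
  near each point; the tube lemma along \<open>at_left\<close> then gives one such level for all of
  \<open>K\<close>.\<close>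

lemma attains_SUP_of_usc:
  fixes f :: "'a::topological_space \<Rightarrow> ereal"
  assumes K: "compact K" "K \<noteq> {}"
    and usc: "\<And>k a. k \<in> K \<Longrightarrow> f k < a \<Longrightarrow> \<forall>\<^sub>F k' in nhds k. k' \<in> K \<longrightarrow> f k' < a"
  shows "\<exists>k\<in>K. f k = (SUP k\<in>K. f k)"
proof (rule ccontr)
  let ?S = "SUP k\<in>K. f k"
  assume "\<not> ?thesis"
  then have less: "f k < ?S" if "k \<in> K" for k
    using that by (metis SUP_upper order_less_le)
  obtain k0 where k0: "k0 \<in> K"
    using K(2) by blast
  \<comment> \<open>The description of \<open>at_left\<close> by an interval needs a point below the
    supremum; a value of \<open>f\<close> serves.\<close>
  note ev_left = eventually_at_left[OF less[OF k0]]
  have "\<forall>\<^sub>F a in at_left ?S. \<forall>k\<in>K. f k < a"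
  proof (rule compact_tube_eventually[OF K(1)])
    fix k assume k: "k \<in> K"
    obtain b where b: "f k < b" "b < ?S"
      using less[OF k] dense by blast
    have left: "\<forall>\<^sub>F a in at_left ?S. b < a"
      unfolding ev_left using b(2) by blast
    show "\<forall>\<^sub>F (k', a) in nhds k \<times>\<^sub>F at_left ?S. k' \<in> K \<longrightarrow> f k' < a"
      by (rule eventually_mono[OF eventually_prodI[OF usc[OF k b(1)] left]])
        (auto intro: order.strict_trans)
  qed
  then have "\<exists>b<?S. \<forall>a>b. a < ?S \<longrightarrow> (\<forall>k\<in>K. f k < a)"
    by (simp only: ev_left)
  then obtain b where b: "b < ?S" "\<And>a. b < a \<Longrightarrow> a < ?S \<Longrightarrow> \<forall>k\<in>K. f k < a"
    by auto
  obtain a where a: "b < a" "a < ?S"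
    using b(1) dense by blast
  have "?S \<le> a"
    using b(2)[OF a] by (intro SUP_least) (auto intro: less_imp_le)
  then show False
    using a by simp
qed

text \<open>The tube lemma has the compact variable first, the joint continuity hypotheses have it
  second.\<close>

lemma eventually_nhds_Pair_swap:
  assumes "eventually P (nhds (y, k))"
  shows "\<forall>\<^sub>F (k', y') in nhds k \<times>\<^sub>F nhds y. P (y', k')"
  using assms unfolding nhds_prod
  by (subst prod_filter_commute) (simp add: eventually_filtermap case_prod_beta')

lemma continuous_on_Times_slices:
  assumes f: "continuous_on (S \<times> K) (\<lambda>(y, k). f y k)"
  shows "y \<in> S \<Longrightarrow> continuous_on K (f y)"
    and "k \<in> K \<Longrightarrow> continuous_on S (\<lambda>y. f y k)"
proof -
  have "continuous_on K (\<lambda>k. (y, k))" "continuous_on S (\<lambda>y. (y, k))"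
    by (intro continuous_on_Pair continuous_on_const continuous_on_id)+
  note * = continuous_on_compose2[OF f this(1)] continuous_on_compose2[OF f this(2)]
  show "y \<in> S \<Longrightarrow> continuous_on K (f y)"
    using *(1) by (simp add: image_subset_iff)
  show "k \<in> K \<Longrightarrow> continuous_on S (\<lambda>y. f y k)"
    using *(2) by (simp add: image_subset_iff)
qed

text \<open>From below, the tube lemma controls all \<open>k\<close> at once; from above, a single
  \<open>k\<close> with value less than \<open>a\<close> suffices.\<close>

lemma continuous_on_INF_compact:
  fixes f :: "'y::topological_space \<Rightarrow> 'k::topological_space \<Rightarrow> real"
  assumes K: "compact K" "K \<noteq> {}"
    and f: "continuous_on (S \<times> K) (\<lambda>(y, k). f y k)"
  shows "continuous_on S (\<lambda>y. INF k\<in>K. f y k)"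
proof -
  note slice = continuous_on_Times_slices[OF f]
  have bdd: "bdd_below (f y ` K)" if "y \<in> S" for y
    using compact_continuous_image[OF slice(1)[OF that] K(1)]
    by (intro bounded_imp_bdd_below compact_imp_bounded)
  show ?thesis
    unfolding continuous_on_real_iff_eventually
  proof (intro ballI allI conjI impI)
    fix y a assume y: "y \<in> S" and a: "a < (INF k\<in>K. f y k)"
    \<comment> \<open>A strict bound on all values gives only a weak bound on the infimum, hence the
      room between \<open>a\<close> and \<open>b\<close>.\<close>
    obtain b where b: "a < b" "b < (INF k\<in>K. f y k)"
      using a dense by blast
    have "\<forall>\<^sub>F y' in nhds y. \<forall>k\<in>K. y' \<in> S \<longrightarrow> b < f y' k"
    proof (rule compact_tube_eventually[OF K(1)])
      fix k assume k: "k \<in> K"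
      have "b < f y k"
        using b(2) cINF_lower[OF bdd[OF y] k] by simp
      then have "\<forall>\<^sub>F p in nhds (y, k). p \<in> S \<times> K \<longrightarrow> b < (\<lambda>(y, k). f y k) p"
        using f y k unfolding continuous_on_real_iff_eventually by auto
      then show "\<forall>\<^sub>F (k', y') in nhds k \<times>\<^sub>F nhds y. k' \<in> K \<longrightarrow> y' \<in> S \<longrightarrow> b < f y' k'"
        using y by (auto dest!: eventually_nhds_Pair_swap elim!: eventually_mono)
    qed
    then show "\<forall>\<^sub>F y' in nhds y. y' \<in> S \<longrightarrow> a < (INF k\<in>K. f y' k)"
    proof eventually_elim
      case (elim y')
      then show ?case
        using b(1) K(2) by (meson cINF_greatest less_imp_le order_less_le_trans)
    qed
  next
    fix y a assume y: "y \<in> S" and a: "(INF k\<in>K. f y k) < a"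
    then obtain k where k: "k \<in> K" "f y k < a"
      using cINF_less_iff[OF K(2) bdd] by blast
    then have "\<forall>\<^sub>F y' in nhds y. y' \<in> S \<longrightarrow> f y' k < a"
      using slice(2)[OF k(1)] y unfolding continuous_on_real_iff_eventually by blast
    then show "\<forall>\<^sub>F y' in nhds y. y' \<in> S \<longrightarrow> (INF k\<in>K. f y' k) < a"
    proof eventually_elim
      case (elim y')
      then show ?case
        using cINF_lower[OF bdd k(1), of y'] by (auto intro: le_less_trans)
    qed
  qed
qed

text \<open>For \<open>y'\<close> near \<open>y\<close>, every point of the compact set
  \<open>K - V\<close> is beaten by the fixed competitor \<open>d y\<close>, so the minimizer
  \<open>d y'\<close> cannot leave \<open>V\<close>.\<close>

lemma continuous_on_unique_minimizer:
  fixes f :: "'y::topological_space \<Rightarrow> 'k::topological_space \<Rightarrow> real"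
  assumes K: "compact K"
    and f: "continuous_on (S \<times> K) (\<lambda>(y, k). f y k)"
    and d: "\<And>y. y \<in> S \<Longrightarrow> d y \<in> K"
    and min: "\<And>y k. y \<in> S \<Longrightarrow> k \<in> K \<Longrightarrow> k \<noteq> d y \<Longrightarrow> f y (d y) < f y k"
  shows "continuous_on S d"
  unfolding continuous_on_def
proof
  fix y assume y: "y \<in> S"
  have "\<forall>\<^sub>F y' in nhds y. y' \<in> S \<longrightarrow> d y' \<in> V" if V: "open V" "d y \<in> V" for V
  proof -
    have cont_d: "continuous_on S (\<lambda>y'. f y' (d y))"
      by (rule continuous_on_Times_slices(2)[OF f d[OF y]])
    have "\<forall>\<^sub>F y' in nhds y. \<forall>k\<in>K - V. y' \<in> S \<longrightarrow> f y' (d y) < f y' k"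
    proof (rule compact_tube_eventually)
      show "compact (K - V)"
        using K V(1) by (simp add: compact_diff)
      fix k assume k: "k \<in> K - V"
      then have "f y (d y) < f y k"
        using V min y by blast
      \<comment> \<open>A level between the two values lets each side be controlled by its own
        neighbourhood.\<close>
      then obtain b where b: "f y (d y) < b" "b < f y k"
        using dense by blast
      have "\<forall>\<^sub>F p in nhds (y, k). p \<in> S \<times> K \<longrightarrow> b < (\<lambda>(y, k). f y k) p"
        using f y k b(2) unfolding continuous_on_real_iff_eventually by auto
      then have upper: "\<forall>\<^sub>F (k', y') in nhds k \<times>\<^sub>F nhds y. (y', k') \<in> S \<times> K \<longrightarrow> b < f y' k'"
        by (auto dest!: eventually_nhds_Pair_swap)
      have "\<forall>\<^sub>F y' in nhds y. y' \<in> S \<longrightarrow> f y' (d y) < b"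
        using cont_d y b(1) unfolding continuous_on_real_iff_eventually by blast
      \<comment> \<open>The conjunct \<open>True\<close> is the condition on the first coordinate
        that \<open>eventually_prodI\<close> expects.\<close>
      then have "\<forall>\<^sub>F p in nhds k \<times>\<^sub>F nhds y. True \<and> (snd p \<in> S \<longrightarrow> f (snd p) (d y) < b)"
        by (intro eventually_prodI) auto
      from eventually_conj[OF upper this]
      show "\<forall>\<^sub>F (k', y') in nhds k \<times>\<^sub>F nhds y. k' \<in> K - V \<longrightarrow> y' \<in> S \<longrightarrow>
          f y' (d y) < f y' k'"
        by (rule eventually_mono) (auto intro: order.strict_trans)
    qed
    then show "\<forall>\<^sub>F y' in nhds y. y' \<in> S \<longrightarrow> d y' \<in> V"
    proof eventually_elim
      case (elim y')
      then show ?case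
        using d min d[OF y] by (metis DiffI order.asym)
    qed
  qed
  then show "(d \<longlongrightarrow> d y) (at y within S)"
    unfolding tendsto_at_iff_tendsto_nhds_within[where f = d and x = y, OF refl]
    unfolding tendsto_def eventually_inf_principal by blast
qed

section \<open>The minimax problem, without the risk measure\<close>

text \<open>First countability of \<open>'z\<close> is what lets the sequential condition (III) be
  read in terms of neighbourhoods.\<close>

locale regret_problem =
  fixes \<Theta> :: "'p::topological_space set"
    and X :: "'x::{real_vector, topological_space} set"
    and c :: "'x \<Rightarrow> 'p \<Rightarrow> real"
    and l :: "real \<Rightarrow> real"
    and r :: real
    and I :: "'p \<Rightarrow> 'z::first_countable_topology \<Rightarrow> ereal"
  assumes Theta: "compact \<Theta>"
    and X: "X \<noteq> {}" "compact X"
    and cost_continuous: "continuous_on (X \<times> \<Theta>) (\<lambda>(x, \<theta>). c x \<theta>)"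
    and cost_strictly_convex: "\<And>\<theta>. \<theta> \<in> \<Theta> \<Longrightarrow> strictly_convex_on X (\<lambda>x. c x \<theta>)"
    and penalty: "mono l" "continuous_on UNIV l" "bij l"
    and rate_nonneg: "\<And>\<theta> z. \<theta> \<in> \<Theta> \<Longrightarrow> 0 \<le> I \<theta> z"
    and rate_finite: "\<And>z. \<exists>\<theta>\<in>\<Theta>. I \<theta> z < \<infinity>"
    and rate_lsc: "lower_semicontinuous_on (\<Theta> \<times> UNIV) (\<lambda>(\<theta>, z). I \<theta> z)"
    and rate_recovery: "\<And>\<theta> z zs. \<theta> \<in> \<Theta> \<Longrightarrow> I \<theta> z < \<infinity> \<Longrightarrow> zs \<longlonglongrightarrow> z \<Longrightarrow>
      \<exists>\<theta>s. range \<theta>s \<subseteq> \<Theta> \<and> \<theta>s \<longlonglongrightarrow> \<theta> \<and> (\<lambda>n. I (\<theta>s n) (zs n)) \<longlonglongrightarrow> I \<theta> z"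
begin

abbreviation "R \<equiv> regret c X"
abbreviation "A \<equiv> adjusted_regret c X l r I"
abbreviation "W \<equiv> worst_regret c X \<Theta> l r I"

section \<open>The inverse penalty and the adjusted regret\<close>

lemma penalty_less_iff: "l s < l t \<longleftrightarrow> s < t"
proof -
  have "strict_mono l"
    using penalty(1,3) by (intro strict_monoI) (metis bij_is_inj injD less_le monoD)
  then show ?thesis
    by (rule strict_mono_less)
qed

text \<open>The extended penalty is injective, so its inverse can be evaluated wherever a preimage
  is exhibited.\<close>

lemma penalty_inverse_simps:
  "penalty_inverse l (ereal (l s)) = ereal s"
  "penalty_inverse l \<infinity> = \<infinity>"
  "penalty_inverse l (- \<infinity>) = - \<infinity>"
proof -
  have "extended_penalty l s = extended_penalty l t \<Longrightarrow> s = t" for s t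
    using penalty(3) by (cases s; cases t) (auto simp: extended_penalty_def dest: bij_is_inj injD)
  then have "inj (extended_penalty l)"
    by (rule injI)
  then have *: "extended_penalty l s = t \<Longrightarrow> penalty_inverse l t = s" for s t
    unfolding penalty_inverse_def by (rule inv_f_eq)
  show "penalty_inverse l (ereal (l s)) = ereal s"
    "penalty_inverse l \<infinity> = \<infinity>" "penalty_inverse l (- \<infinity>) = - \<infinity>"
    by (rule *, simp add: extended_penalty_def)+
qed

text \<open>For a finite rate, \<open>s\<close> solves \<open>l s = I \<theta> z - r\<close> and
  does not depend on \<open>x\<close>: in \<open>x\<close> the adjusted regret is the regret up to a
  constant, which is what later transfers strict convexity.\<close>

lemma adjusted_regret_cases:
  assumes "\<theta> \<in> \<Theta>"
  obtains "I \<theta> z = \<infinity>" "\<And>x. A z x \<theta> = - \<infinity>"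
  | s where "I \<theta> z = ereal (l s + r)" "\<And>x. A z x \<theta> = ereal (R x \<theta> - s)"
proof (cases "I \<theta> z")
  case (real i)
  obtain s where "l s = i - r"
    using penalty(3) by (metis bij_pointE)
  then have "I \<theta> z = ereal (l s + r)"
    using real by simp
  then show ?thesis
    by (intro that(2)[of s]) (simp_all add: adjusted_regret_def penalty_inverse_simps)
next
  case PInf
  then show ?thesis
    by (intro that(1)) (simp_all add: adjusted_regret_def penalty_inverse_simps)
next
  case MInf
  then show ?thesis
    using rate_nonneg[OF assms, of z] by simp
qed

text \<open>These two equivalences trade \<open>\<ell>\<^sup>-\<^sup>1\<close> on the extended reals for the real function \<open>\<ell>\<close>.\<close>

lemma adjusted_regret_less_iff:
  assumes "\<theta> \<in> \<Theta>"
  shows "A z x \<theta> < ereal a \<longleftrightarrow> ereal (l (R x \<theta> - a) + r) < I \<theta> z"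
proof (rule adjusted_regret_cases[OF assms, of z])
  fix s assume "I \<theta> z = ereal (l s + r)" "\<And>x. A z x \<theta> = ereal (R x \<theta> - s)"
  then show ?thesis
    by (auto simp: penalty_less_iff)
qed simp

lemma less_adjusted_regret_iff:
  assumes "\<theta> \<in> \<Theta>"
  shows "ereal a < A z x \<theta> \<longleftrightarrow> I \<theta> z < ereal (l (R x \<theta> - a) + r)"
proof (rule adjusted_regret_cases[OF assms, of z])
  fix s assume "I \<theta> z = ereal (l s + r)" "\<And>x. A z x \<theta> = ereal (R x \<theta> - s)"
  then show ?thesis
    by (auto simp: penalty_less_iff)
qed simp

section \<open>Joint continuity of the regret\<close>

lemma cost_attains_min:
  assumes "\<theta> \<in> \<Theta>"
  shows "\<exists>y\<in>X. c y \<theta> = (INF x\<in>X. c x \<theta>)"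
proof -
  have "continuous_on X (\<lambda>x. c x \<theta>)"
    by (rule continuous_on_Times_slices(2)[OF cost_continuous assms])
  then obtain y where "y \<in> X" "\<And>x. x \<in> X \<Longrightarrow> c y \<theta> \<le> c x \<theta>"
    using continuous_attains_inf[OF X(2,1)] by blast
  then show ?thesis
    by (intro bexI[of _ y] cInf_eq_minimum[symmetric]) auto
qed

lemma continuous_on_regret: "continuous_on (X \<times> \<Theta>) (\<lambda>(x, \<theta>). R x \<theta>)"
proof -
  \<comment> \<open>\<open>continuous_on_INF_compact\<close> minimizes over the second coordinate,
    so the coordinates of the cost are swapped.\<close>
  have "continuous_on (\<Theta> \<times> X) (\<lambda>p. (snd p, fst p))"
    by (intro continuous_intros)
  then have "continuous_on (\<Theta> \<times> X) (\<lambda>(\<theta>, x). c x \<theta>)"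
    using continuous_on_compose2[OF cost_continuous, of _ "\<lambda>p. (snd p, fst p)"]
    by (auto simp: case_prod_beta' image_subset_iff)
  then have "continuous_on \<Theta> (\<lambda>\<theta>. INF x\<in>X. c x \<theta>)"
    by (rule continuous_on_INF_compact[OF X(2,1)])
  then have "continuous_on (X \<times> \<Theta>) (\<lambda>p. INF x\<in>X. c x (snd p))"
    by (rule continuous_on_compose2) (auto intro: continuous_intros)
  then show ?thesis
    using cost_continuous unfolding regret_def case_prod_beta' by (intro continuous_on_diff)
qed

section \<open>Semicontinuity in the parameter and the data point\<close>

text \<open>Condition (II) in neighbourhood form. The \<open>Liminf\<close> ignores the point
  itself, where the bound holds by assumption.\<close>

lemma eventually_rate_greater:
  assumes "\<theta> \<in> \<Theta>" "b < I \<theta> z"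
  shows "\<forall>\<^sub>F (\<theta>', z') in nhds (\<theta>, z). \<theta>' \<in> \<Theta> \<longrightarrow> b < I \<theta>' z'"
proof -
  have "(\<lambda>(\<theta>, z). I \<theta> z) (\<theta>, z) \<le>
      Liminf (at (\<theta>, z) within \<Theta> \<times> UNIV) (\<lambda>(\<theta>, z). I \<theta> z)"
    using rate_lsc assms(1) unfolding lower_semicontinuous_on_def by blast
  then have "b < Liminf (at (\<theta>, z) within \<Theta> \<times> UNIV) (\<lambda>(\<theta>, z). I \<theta> z)"
    using assms(2) by (simp add: order_less_le_trans)
  then have "\<forall>\<^sub>F p in at (\<theta>, z) within \<Theta> \<times> UNIV. b < (\<lambda>(\<theta>, z). I \<theta> z) p"
    by (rule less_LiminfD)
  then show ?thesis
    unfolding eventually_at_filter by (rule eventually_mono) (use assms(2) in auto)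
qed

text \<open>Condition (III) in neighbourhood form: along any sequence tending to \<open>z\<close>,
  the recovery sequence eventually lies in the neighbourhood \<open>N\<close> and has rate below
  \<open>b\<close>.\<close>

lemma eventually_ex_rate_less:
  assumes "\<theta> \<in> \<Theta>" "I \<theta> z < b" "eventually N (nhds \<theta>)"
  shows "\<forall>\<^sub>F z' in nhds z. \<exists>\<theta>'\<in>\<Theta>. N \<theta>' \<and> I \<theta>' z' < b"
  unfolding eventually_nhds_iff_sequentially
proof (intro allI impI)
  fix zs assume "zs \<longlonglongrightarrow> z"
  moreover have "I \<theta> z < \<infinity>"
    using assms(2) by (rule less_le_trans) simp
  ultimately obtain \<theta>s where \<theta>s: "range \<theta>s \<subseteq> \<Theta>" "\<theta>s \<longlonglongrightarrow> \<theta>"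
    and rate: "(\<lambda>n. I (\<theta>s n) (zs n)) \<longlonglongrightarrow> I \<theta> z"
    using rate_recovery assms(1) by blast
  have "\<forall>\<^sub>F n in sequentially. N (\<theta>s n)"
    using assms(3) \<theta>s(2) by (simp add: eventually_compose_filterlim)
  moreover have "\<forall>\<^sub>F n in sequentially. I (\<theta>s n) (zs n) < b"
    using order_tendstoD(2)[OF rate assms(2)] .
  ultimately show "\<forall>\<^sub>F n in sequentially. \<exists>\<theta>'\<in>\<Theta>. N \<theta>' \<and> I \<theta>' (zs n) < b"
    by eventually_elim (use \<theta>s(1) in blast)
qed

lemma continuous_on_penalty_regret:
  "continuous_on (X \<times> \<Theta>) (\<lambda>(x, \<theta>). l (R x \<theta> - a) + r)"
proof -
  have "continuous_on (X \<times> \<Theta>) (\<lambda>p. R (fst p) (snd p) - a)"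
    using continuous_on_regret by (auto simp: case_prod_beta' intro: continuous_intros)
  from continuous_on_compose2[OF penalty(2) this] show ?thesis
    unfolding case_prod_beta' by (intro continuous_on_add continuous_on_const) auto
qed

text \<open>Joint upper semicontinuity. The parameter comes first so that the tube lemma over
  \<open>\<Theta>\<close> applies.\<close>

lemma eventually_adjusted_regret_less:
  assumes x: "x \<in> X" and \<theta>: "\<theta> \<in> \<Theta>" and less: "A z x \<theta> < ereal a"
  shows "\<forall>\<^sub>F (\<theta>', z', x') in nhds \<theta> \<times>\<^sub>F nhds (z, x). \<theta>' \<in> \<Theta> \<longrightarrow> x' \<in> X \<longrightarrow> A z' x' \<theta>' < ereal a"
proof -
  \<comment> \<open>The real level \<open>b\<close> separates the penalty side, handled by
    continuity, from the rate side, handled by (II).\<close>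
  obtain b where b: "ereal (l (R x \<theta> - a) + r) < ereal b" "ereal b < I \<theta> z"
    using less ereal_dense2 unfolding adjusted_regret_less_iff[OF \<theta>] by blast
  have "\<forall>\<^sub>F p in nhds (x, \<theta>). p \<in> X \<times> \<Theta> \<longrightarrow> (\<lambda>(x, \<theta>). l (R x \<theta> - a) + r) p < b"
    using continuous_on_penalty_regret[of a] x \<theta> b(1)
    unfolding continuous_on_real_iff_eventually by auto
  then obtain N1 N2 where N: "eventually N1 (nhds x)" "eventually N2 (nhds \<theta>)"
    and N_less: "\<And>x' \<theta>'. N1 x' \<Longrightarrow> N2 \<theta>' \<Longrightarrow> x' \<in> X \<Longrightarrow> \<theta>' \<in> \<Theta> \<Longrightarrow> l (R x' \<theta>' - a) + r < b"
    unfolding nhds_prod eventually_prod_filter by auto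
  obtain M1 M2 where M: "eventually M1 (nhds \<theta>)" "eventually M2 (nhds z)"
    and M_less: "\<And>\<theta>' z'. M1 \<theta>' \<Longrightarrow> M2 z' \<Longrightarrow> \<theta>' \<in> \<Theta> \<Longrightarrow> ereal b < I \<theta>' z'"
    using eventually_rate_greater[OF \<theta> b(2)] unfolding nhds_prod eventually_prod_filter by auto
  have "\<forall>\<^sub>F p in nhds (z, x). M2 (fst p) \<and> N1 (snd p)"
    unfolding nhds_prod using M(2) N(1) by (rule eventually_prodI)
  with eventually_conj[OF N(2) M(1)]
  have "\<forall>\<^sub>F q in nhds \<theta> \<times>\<^sub>F nhds (z, x).
      (N2 (fst q) \<and> M1 (fst q)) \<and> (M2 (fst (snd q)) \<and> N1 (snd (snd q)))"
    by (rule eventually_prodI)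
  then show ?thesis
  proof (rule eventually_mono, clarify, simp only: fst_conv snd_conv)
    fix \<theta>' z' x'
    assume *: "N2 \<theta>'" "M1 \<theta>'" "M2 z'" "N1 x'" "\<theta>' \<in> \<Theta>" "x' \<in> X"
    have "ereal (l (R x' \<theta>' - a) + r) < ereal b"
      using N_less * by simp
    also have "ereal b < I \<theta>' z'"
      using M_less * by simp
    finally show "A z' x' \<theta>' < ereal a"
      using adjusted_regret_less_iff * by simp
  qed
qed

section \<open>Attainment and joint continuity of the worst adjusted regret\<close>

lemma Theta_nonempty: "\<Theta> \<noteq> {}"
  using rate_finite by blast

lemma worst_regret_attained:
  assumes "x \<in> X"
  shows "\<exists>\<theta>\<in>\<Theta>. A z x \<theta> = W z x"
  unfolding worst_regret_def
proof (rule attains_SUP_of_usc[OF Theta Theta_nonempty])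
  fix \<theta> a assume \<theta>: "\<theta> \<in> \<Theta>" and "A z x \<theta> < a"
  \<comment> \<open>The level \<open>a\<close> may be infinite, while
    \<open>eventually_adjusted_regret_less\<close> takes a real one.\<close>
  then obtain b where b: "A z x \<theta> < ereal b" "ereal b < a"
    using ereal_dense2 by blast
  obtain N M where "eventually N (nhds \<theta>)" "eventually M (nhds (z, x))"
    and N: "\<And>\<theta>' z' x'. N \<theta>' \<Longrightarrow> M (z', x') \<Longrightarrow> \<theta>' \<in> \<Theta> \<Longrightarrow> x' \<in> X \<Longrightarrow> A z' x' \<theta>' < ereal b"
    using eventually_adjusted_regret_less[OF assms \<theta> b(1)]
    unfolding eventually_prod_filter by auto
  moreover have "M (z, x)"
    using \<open>eventually M (nhds (z, x))\<close> by (rule eventually_nhds_x_imp_x)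
  ultimately show "\<forall>\<^sub>F \<theta>' in nhds \<theta>. \<theta>' \<in> \<Theta> \<longrightarrow> A z x \<theta>' < a"
    using assms b(2) by (auto elim!: eventually_mono intro: order.strict_trans)
qed

lemma worst_regret_upper: "\<theta> \<in> \<Theta> \<Longrightarrow> A z x \<theta> \<le> W z x"
  unfolding worst_regret_def by (rule SUP_upper)

text \<open>By (I) some parameter has finite rate, so the supremum exceeds
  \<open>- \<infinity>\<close> and a maximizer must have finite rate as well.\<close>

lemma worst_regret_attained_real:
  assumes "x \<in> X"
  obtains \<theta> s where "\<theta> \<in> \<Theta>" "\<And>x. A z x \<theta> = ereal (R x \<theta> - s)" "W z x = ereal (R x \<theta> - s)"
proof -
  obtain \<theta>0 where \<theta>0: "\<theta>0 \<in> \<Theta>" "I \<theta>0 z < \<infinity>"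
    using rate_finite by blast
  then have "W z x \<noteq> - \<infinity>"
    using worst_regret_upper[OF \<theta>0(1), of z x] adjusted_regret_cases[OF \<theta>0(1), of z] by force
  moreover obtain \<theta> where "\<theta> \<in> \<Theta>" "A z x \<theta> = W z x"
    using worst_regret_attained[OF assms] by blast
  ultimately show ?thesis
    using that adjusted_regret_cases[of \<theta> z] by metis
qed

text \<open>Real-valued version used for continuity and minimization; \<open>worst_regret_eq\<close>
  shows that nothing is lost on \<open>X\<close>.\<close>

definition worst :: "'z \<Rightarrow> 'x \<Rightarrow> real" where
  "worst z x = real_of_ereal (W z x)"

lemma worst_regret_eq: "x \<in> X \<Longrightarrow> W z x = ereal (worst z x)"
  unfolding worst_def by (metis worst_regret_attained_real real_of_ereal.simps(1))

text \<open>The lower half follows a maximizing parameter by means of (III); the upper half is the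
  tube lemma over \<open>\<Theta>\<close> applied to the upper semicontinuity of the adjusted
  regret.\<close>

lemma continuous_on_worst_regret: "continuous_on (UNIV \<times> X) (\<lambda>(z, x). worst z x)"
proof -
  have lower: "\<forall>\<^sub>F p in nhds (z, x). snd p \<in> X \<longrightarrow> a < worst (fst p) (snd p)"
    if x: "x \<in> X" and a: "a < worst z x" for z x a
  proof -
    obtain \<theta> where \<theta>: "\<theta> \<in> \<Theta>" "A z x \<theta> = W z x"
      using worst_regret_attained[OF x] by blast
    then have "I \<theta> z < ereal (l (R x \<theta> - a) + r)"
      using a worst_regret_eq[OF x] by (simp flip: less_adjusted_regret_iff)
    then obtain b where b: "I \<theta> z < ereal b" "ereal b < ereal (l (R x \<theta> - a) + r)"
      using ereal_dense2 by blast
    have "\<forall>\<^sub>F p in nhds (x, \<theta>). p \<in> X \<times> \<Theta> \<longrightarrow> b < (\<lambda>(x, \<theta>). l (R x \<theta> - a) + r) p"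
      using continuous_on_penalty_regret[of a] x \<theta>(1) b(2)
      unfolding continuous_on_real_iff_eventually by auto
    then obtain N1 N2 where N: "eventually N1 (nhds x)" "eventually N2 (nhds \<theta>)"
      and N_less: "\<And>x' \<theta>'. N1 x' \<Longrightarrow> N2 \<theta>' \<Longrightarrow> x' \<in> X \<Longrightarrow> \<theta>' \<in> \<Theta> \<Longrightarrow> b < l (R x' \<theta>' - a) + r"
      unfolding nhds_prod eventually_prod_filter by auto
    \<comment> \<open>The parameter found near \<open>\<theta>\<close> varies with the data point;
      this is harmless, as any parameter bounds the supremum from below.\<close>
    have "\<forall>\<^sub>F p in nhds (z, x). (\<exists>\<theta>'\<in>\<Theta>. N2 \<theta>' \<and> I \<theta>' (fst p) < ereal b) \<and> N1 (snd p)"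
      unfolding nhds_prod using eventually_ex_rate_less[OF \<theta>(1) b(1) N(2)] N(1)
      by (rule eventually_prodI)
    then show "\<forall>\<^sub>F p in nhds (z, x). snd p \<in> X \<longrightarrow> a < worst (fst p) (snd p)"
    proof (rule eventually_mono, clarify, simp only: fst_conv snd_conv)
      fix z' x' \<theta>'
      assume *: "N1 x'" "\<theta>' \<in> \<Theta>" "N2 \<theta>'" "x' \<in> X" and "I \<theta>' z' < ereal b"
      note this(5)
      also have "ereal b < ereal (l (R x' \<theta>' - a) + r)"
        using N_less * by simp
      finally have "ereal a < A z' x' \<theta>'"
        using less_adjusted_regret_iff * by simp
      also have "\<dots> \<le> ereal (worst z' x')"
        using worst_regret_upper * by (simp flip: worst_regret_eq)
      finally show "a < worst z' x'"
        by simp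
    qed
  qed
  have upper: "\<forall>\<^sub>F p in nhds (z, x). snd p \<in> X \<longrightarrow> worst (fst p) (snd p) < a"
    if x: "x \<in> X" and a: "worst z x < a" for z x a
  proof -
    have "\<forall>\<^sub>F p in nhds (z, x). \<forall>\<theta>\<in>\<Theta>. snd p \<in> X \<longrightarrow> A (fst p) (snd p) \<theta> < ereal a"
    proof (rule compact_tube_eventually[OF Theta])
      fix \<theta> assume \<theta>: "\<theta> \<in> \<Theta>"
      have "A z x \<theta> \<le> ereal (worst z x)"
        using worst_regret_upper[OF \<theta>] x by (simp flip: worst_regret_eq)
      also have "\<dots> < ereal a"
        using a by simp
      finally show "\<forall>\<^sub>F (\<theta>', p) in nhds \<theta> \<times>\<^sub>F nhds (z, x).
          \<theta>' \<in> \<Theta> \<longrightarrow> snd p \<in> X \<longrightarrow> A (fst p) (snd p) \<theta>' < ereal a"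
        using eventually_adjusted_regret_less[OF x \<theta>] by (simp add: case_prod_beta')
    qed
    then show "\<forall>\<^sub>F p in nhds (z, x). snd p \<in> X \<longrightarrow> worst (fst p) (snd p) < a"
    proof eventually_elim
      case (elim p)
      \<comment> \<open>Since the supremum is attained, the strict bound for every parameter passes
        to it.\<close>
      then show ?case
        using worst_regret_attained[of "snd p" "fst p"] worst_regret_eq[of "snd p" "fst p"] by force
    qed
  qed
  show ?thesis
    unfolding continuous_on_real_iff_eventually
  proof (intro ballI allI)
    fix p :: "'z \<times> 'x" and a assume "p \<in> UNIV \<times> X"
    then obtain z x where "p = (z, x)" "x \<in> X"
      by auto
    then show "(a < (case p of (z, x) \<Rightarrow> worst z x) \<longrightarrow>
          (\<forall>\<^sub>F q in nhds p. q \<in> UNIV \<times> X \<longrightarrow> a < (case q of (z, x) \<Rightarrow> worst z x))) \<and>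
        ((case p of (z, x) \<Rightarrow> worst z x) < a \<longrightarrow>
          (\<forall>\<^sub>F q in nhds p. q \<in> UNIV \<times> X \<longrightarrow> (case q of (z, x) \<Rightarrow> worst z x) < a))"
      using lower upper by (simp add: case_prod_beta' mem_Times_iff)
  qed
qed

section \<open>Strict convexity and the unique minimizer\<close>

text \<open>A supremum of strictly convex functions need not be strictly convex; here a parameter
  maximizing at the midpoint exists, and the strict inequality for its cost carries over.\<close>

lemma worst_regret_midpoint_less:
  assumes "x \<in> X" "y \<in> X" "x \<noteq> y"
  shows "\<exists>m\<in>X. worst z m < (worst z x + worst z y) / 2"
proof -
  \<comment> \<open>The weight is written \<open>1 - 1/2\<close> to match
    \<open>strictly_convex_on\<close> at \<open>t = 1/2\<close>.\<close>
  let ?m = "(1 - 1/2) *\<^sub>R x + (1/2::real) *\<^sub>R y"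
  have conv: "strictly_convex_on X (\<lambda>x. c x \<theta>)" if "\<theta> \<in> \<Theta>" for \<theta>
    using cost_strictly_convex that .
  have "convex X"
    using conv Theta_nonempty unfolding strictly_convex_on_def by blast
  then have m: "?m \<in> X"
    using assms by (intro convexD) auto
  obtain \<theta> s where \<theta>: "\<theta> \<in> \<Theta>" "\<And>x. A z x \<theta> = ereal (R x \<theta> - s)" "W z ?m = ereal (R ?m \<theta> - s)"
    using worst_regret_attained_real[OF m] by metis
  have upper: "R x' \<theta> - s \<le> worst z x'" if "x' \<in> X" for x'
    using worst_regret_upper[OF \<theta>(1), of z x'] that \<theta>(2) by (simp add: worst_regret_eq)
  have "c ?m \<theta> < (1 - 1/2) * c x \<theta> + 1/2 * c y \<theta>"
  proof -
    have "\<forall>t. x \<noteq> y \<longrightarrow> 0 < t \<longrightarrow> t < 1 \<longrightarrow>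
        c ((1 - t) *\<^sub>R x + t *\<^sub>R y) \<theta> < (1 - t) * c x \<theta> + t * c y \<theta>"
      using conv[OF \<theta>(1)] assms(1,2) unfolding strictly_convex_on_def by blast
    from spec[OF this, of "1/2"] assms(3) show ?thesis
      by simp
  qed
  then have "R ?m \<theta> < (R x \<theta> + R y \<theta>) / 2"
    unfolding regret_def by (simp add: field_simps)
  moreover have "worst z ?m = R ?m \<theta> - s"
    using \<theta>(3) by (simp add: worst_def)
  ultimately have "worst z ?m < (worst z x + worst z y) / 2"
    using upper[OF assms(1)] upper[OF assms(2)] by (simp add: field_simps)
  with m show ?thesis
    by blast
qed

text \<open>Compactness and continuity give existence; the midpoint of two distinct minimizers would
  beat both.\<close>

lemma ex1_worst_regret_minimizer: "\<exists>!x. is_arg_min (W z) (\<lambda>x. x \<in> X) x"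
proof -
  have iff: "is_arg_min (W z) (\<lambda>x. x \<in> X) x \<longleftrightarrow> x \<in> X \<and> (\<forall>y\<in>X. worst z x \<le> worst z y)" for x
    unfolding is_arg_min_linorder by (auto simp: worst_regret_eq)
  have "continuous_on X (worst z)"
    by (rule continuous_on_Times_slices(1)[OF continuous_on_worst_regret]) simp
  then obtain x where x: "x \<in> X" "\<forall>y\<in>X. worst z x \<le> worst z y"
    using continuous_attains_inf[OF X(2,1)] by blast
  have "y = x" if y: "y \<in> X" "\<forall>x\<in>X. worst z y \<le> worst z x" for y
  proof (rule ccontr)
    assume "y \<noteq> x"
    then obtain m where "m \<in> X" "worst z m < (worst z y + worst z x) / 2"
      using worst_regret_midpoint_less[OF y(1) x(1)] by blast
    moreover have "worst z x = worst z y"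
      using x y by (simp add: order_antisym)
    ultimately show False
      using x(2) by fastforce
  qed
  then show ?thesis
    unfolding iff using x by blast
qed

section \<open>The optimal pair and its continuity\<close>

abbreviation "xstar \<equiv> X_star c X \<Theta> l r I"
abbreviation "ustar \<equiv> u_star c X \<Theta> l r I"

lemma X_star_is_arg_min: "is_arg_min (W z) (\<lambda>x. x \<in> X) (xstar z)"
  unfolding X_star_def arg_min_on_def arg_min_def
  using ex1_worst_regret_minimizer by (rule someI_ex[OF ex1_implies_ex])

lemma X_star_mem: "xstar z \<in> X"
  using X_star_is_arg_min unfolding is_arg_min_def by blast

text \<open>Uniqueness recast as the strict inequality that
  \<open>continuous_on_unique_minimizer\<close> asks for.\<close>

lemma X_star_less:
  assumes "x \<in> X" "x \<noteq> xstar z"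
  shows "worst z (xstar z) < worst z x"
proof -
  have "\<not> is_arg_min (W z) (\<lambda>x. x \<in> X) x"
    using ex1_worst_regret_minimizer X_star_is_arg_min assms(2) by blast
  then obtain y where "y \<in> X" "W z y < W z x"
    using assms(1) unfolding is_arg_min_def by blast
  moreover have "W z (xstar z) \<le> W z y"
    using X_star_is_arg_min \<open>y \<in> X\<close> unfolding is_arg_min_linorder by blast
  ultimately have "W z (xstar z) < W z x"
    by simp
  then show ?thesis
    using assms(1) X_star_mem by (simp add: worst_regret_eq)
qed

lemma worst_regret_X_star: "W z (xstar z) = (INF x\<in>X. W z x)"
  using X_star_is_arg_min X_star_mem unfolding is_arg_min_linorder
  by (intro antisym INF_greatest INF_lower) auto

lemma u_star_eq: "ustar z = worst z (xstar z)"
  unfolding u_star_def worst_regret_X_star[symmetric] worst_def ..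

text \<open>The infimum is attained at \<open>xstar z\<close> and hence real, so
  \<open>real_of_ereal\<close> in \<open>u_star\<close> does not alter it.\<close>

lemma ereal_u_star: "ereal (ustar z) = (INF x\<in>X. W z x)"
  using worst_regret_X_star X_star_mem by (simp add: u_star_eq worst_regret_eq)

lemma u_star_lower: "x \<in> X \<Longrightarrow> ereal (ustar z) \<le> W z x"
  unfolding ereal_u_star by (rule INF_lower)

lemma continuous_on_X_star: "continuous_on UNIV xstar"
  by (rule continuous_on_unique_minimizer[OF X(2) continuous_on_worst_regret])
    (simp_all add: X_star_mem X_star_less)

lemma continuous_on_u_star: "continuous_on UNIV ustar"
proof -
  have "continuous_on UNIV (\<lambda>z. (z, xstar z))"
    by (intro continuous_on_Pair continuous_on_id continuous_on_X_star)
  from continuous_on_compose2[OF continuous_on_worst_regret this] show ?thesis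
    using X_star_mem by (simp add: u_star_eq image_subset_iff)
qed

text \<open>Under the Laplace principle this is the risk constraint of a decision rule \<open>d\<close> with bound \<open>u\<close>.\<close>

lemma SUP_penalty_le_iff:
  assumes "\<theta> \<in> \<Theta>"
  shows "(SUP z. ereal (l (R (d z) \<theta> - u z)) - I \<theta> z) \<le> ereal (- r) \<longleftrightarrow>
    (\<forall>z. A z (d z) \<theta> \<le> ereal (u z))"
proof -
  \<comment> \<open>Negating both sides reduces this to \<open>less_adjusted_regret_iff\<close>;
    what remains is moving \<open>r\<close> and the rate across the inequality.\<close>
  have "ereal (l (R (d z) \<theta> - u z)) - I \<theta> z \<le> ereal (- r) \<longleftrightarrow> A z (d z) \<theta> \<le> ereal (u z)" for z
    unfolding not_less[symmetric] less_adjusted_regret_iff[OF assms]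
    by (cases "I \<theta> z") auto
  then show ?thesis
    by (simp add: SUP_le_iff)
qed

end

section \<open>Feasibility and optimality under the Laplace principle\<close>

theorem theorem2p5:
  fixes \<Theta> :: "'p::real_topological_vector_space set"
    and X :: "'x::real_topological_vector_space set"
    and F :: "'w measure"
    and P :: "'p \<Rightarrow> 'w measure"
    and Z :: "nat \<Rightarrow> 'w \<Rightarrow> 'z::metric_space"
    and c :: "'x \<Rightarrow> 'p \<Rightarrow> real"
    and l :: "real \<Rightarrow> real"
    and r :: real
    and \<phi> :: "'p \<Rightarrow> (nat \<Rightarrow> 'w \<Rightarrow> real) \<Rightarrow> ereal"
    and I :: "'p \<Rightarrow> 'z \<Rightarrow> ereal"
  assumes Theta: "\<Theta> \<noteq> {}" "compact \<Theta>" "convex \<Theta>" "metrizable_space (top_of_set \<Theta>)"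
    and X: "X \<noteq> {}" "compact X" "convex X" "metrizable_space (top_of_set X)"
    and prob: "\<And>\<theta>. \<theta> \<in> \<Theta> \<Longrightarrow> prob_space (P \<theta>)"
      "\<And>\<theta>. \<theta> \<in> \<Theta> \<Longrightarrow> sets (P \<theta>) = sets F"
    and random_variables: "\<And>n. Z n \<in> measurable F borel"
    and cost_continuous: "continuous_on (X \<times> \<Theta>) (\<lambda>(x, \<theta>). c x \<theta>)"
    and cost_strictly_convex: "\<And>\<theta>. \<theta> \<in> \<Theta> \<Longrightarrow> strictly_convex_on X (\<lambda>x. c x \<theta>)"
    and penalty: "mono l" "continuous_on UNIV l" "bij l" "l 0 = 0"
    and r_pos: "r > 0"
    and rate_nonneg: "\<And>\<theta> z. \<theta> \<in> \<Theta> \<Longrightarrow> 0 \<le> I \<theta> z"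
    and laplace: "\<And>f \<theta>. continuous_on UNIV f \<Longrightarrow> \<theta> \<in> \<Theta> \<Longrightarrow>
      \<phi> \<theta> (\<lambda>n \<omega>. f (Z n \<omega>)) = (SUP z. ereal (f z) - I \<theta> z)"
    and reg_I: "\<And>z. \<exists>\<theta>\<in>\<Theta>. I \<theta> z < \<infinity>"
    and reg_II: "lower_semicontinuous_on (\<Theta> \<times> UNIV) (\<lambda>(\<theta>, z). I \<theta> z)"
    and reg_III: "\<And>\<theta> z zs. \<theta> \<in> \<Theta> \<Longrightarrow> I \<theta> z < \<infinity> \<Longrightarrow> zs \<longlonglongrightarrow> z \<Longrightarrow>
      \<exists>\<theta>s. range \<theta>s \<subseteq> \<Theta> \<and> \<theta>s \<longlonglongrightarrow> \<theta> \<and> (\<lambda>n. I (\<theta>s n) (zs n)) \<longlonglongrightarrow> I \<theta> z"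
  shows "(\<forall>\<theta>\<in>\<Theta>. \<exists>y\<in>X. c y \<theta> = (INF x\<in>X. c x \<theta>)) \<and>
    (\<forall>z. \<forall>x\<in>X. \<exists>\<theta>\<in>\<Theta>. adjusted_regret c X l r I z x \<theta> = worst_regret c X \<Theta> l r I z x) \<and>
    (\<forall>z. \<exists>!x. is_arg_min (worst_regret c X \<Theta> l r I z) (\<lambda>x. x \<in> X) x) \<and>
    (\<forall>z. ereal (u_star c X \<Theta> l r I z) = (INF x\<in>X. worst_regret c X \<Theta> l r I z x)) \<and>
    feasible c X \<Theta> l r \<phi> Z (X_star c X \<Theta> l r I) (u_star c X \<Theta> l r I) \<and>
    (\<forall>d u. feasible c X \<Theta> l r \<phi> Z d u \<longrightarrow> (\<forall>z. u_star c X \<Theta> l r I z \<le> u z))"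
proof -
  interpret regret_problem \<Theta> X c l r I
    by unfold_locales (fact Theta X cost_continuous cost_strictly_convex penalty rate_nonneg
        reg_I reg_II reg_III)+
  \<comment> \<open>The Laplace principle speaks of continuous functions of the data, so continuity
    of \<open>d\<close>, \<open>u\<close>, the regret and \<open>l\<close> is combined
    first.\<close>
  have risk: "\<phi> \<theta> (\<lambda>n \<omega>. l (R (d (Z n \<omega>)) \<theta> - u (Z n \<omega>))) \<le> ereal (- r) \<longleftrightarrow>
      (\<forall>z. A z (d z) \<theta> \<le> ereal (u z))"
    if \<theta>: "\<theta> \<in> \<Theta>" and d: "continuous_on UNIV d" "range d \<subseteq> X" and u: "continuous_on UNIV u" for \<theta> d u
  proof -
    have "continuous_on X (\<lambda>x. R x \<theta>)"
      by (rule continuous_on_Times_slices(2)[OF continuous_on_regret \<theta>])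
    from continuous_on_compose2[OF this d] have "continuous_on UNIV (\<lambda>z. R (d z) \<theta> - u z)"
      using u by (rule continuous_on_diff)
    from continuous_on_compose2[OF penalty(2) this]
    have "continuous_on UNIV (\<lambda>z. l (R (d z) \<theta> - u z))"
      by simp
    from laplace[OF this \<theta>] SUP_penalty_le_iff[OF \<theta>] show ?thesis
      by simp
  qed
  have "feasible c X \<Theta> l r \<phi> Z xstar ustar"
    unfolding feasible_def
  proof (intro conjI ballI)
    fix \<theta> assume \<theta>: "\<theta> \<in> \<Theta>"
    \<comment> \<open>\<open>ustar z\<close> is the worst adjusted regret at \<open>xstar z\<close>,
      which dominates that of each parameter.\<close>
    have "A z (xstar z) \<theta> \<le> ereal (ustar z)" for z
      unfolding ereal_u_star worst_regret_X_star[symmetric] by (rule worst_regret_upper[OF \<theta>])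
    then show "\<phi> \<theta> (\<lambda>n \<omega>. l (R (xstar (Z n \<omega>)) \<theta> - ustar (Z n \<omega>))) \<le> ereal (- r)"
      using risk[OF \<theta> continuous_on_X_star _ continuous_on_u_star] X_star_mem by blast
  qed (use continuous_on_X_star continuous_on_u_star X_star_mem in auto)
  moreover have "ustar z \<le> u z" if "feasible c X \<Theta> l r \<phi> Z d u" for d u z
  proof -
    have d: "continuous_on UNIV d" "range d \<subseteq> X" "continuous_on UNIV u"
      and "\<forall>\<theta>\<in>\<Theta>. \<phi> \<theta> (\<lambda>n \<omega>. l (R (d (Z n \<omega>)) \<theta> - u (Z n \<omega>))) \<le> ereal (- r)"
      using that unfolding feasible_def by auto
    then have "A z (d z) \<theta> \<le> ereal (u z)" if "\<theta> \<in> \<Theta>" for \<theta>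
      using risk[OF that d] that by blast
    \<comment> \<open>The constraints for all parameters together bound the supremum at the decision
      \<open>d z\<close>, which is in turn at least the minimum \<open>ustar z\<close>.\<close>
    then have "W z (d z) \<le> ereal (u z)"
      unfolding worst_regret_def by (rule SUP_least)
    moreover have "ereal (ustar z) \<le> W z (d z)"
      using u_star_lower d(2) by blast
    ultimately have "ereal (ustar z) \<le> ereal (u z)"
      by (rule order_trans[rotated])
    then show ?thesis
      by simp
  qed
  ultimately show ?thesis
    using cost_attains_min worst_regret_attained ex1_worst_regret_minimizer ereal_u_star by blast
qed

end
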